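(* There is an absolute constant $c>0$ such that for every integer $n$ and every $\varepsilon\in(1/\sqrt n,1)$ there is an $n$-vertex graph $G$ for which every $(1+\varepsilon)$-cut sparsifier $H$ of $G$ has at least $c\,n/\varepsilon^2$ edges, even if $H$ is not required to be a subgraph of $G$.
   Context: Graphs are undirected, possibly with positive edge weights (an unweighted graph has all edge weights equal to $1$). For a graph $G=(V,E,w)$ and $S\subset V$, $w_G(S,\bar S)$ denotes the total weight of the edges of $G$ with exactly one endpoint in $S$. A $(1+\varepsilon)$-cut sparsifier of $G$ is a positively edge-weighted graph $H$ on the same vertex set $V$ such that $(1-\varepsilon)w_G(S,\bar S)\le w_H(S,\bar S)\le(1+\varepsilon)w_G(S,\bar S)$ for every $S\subset V$. *)

theory Defs
  imports Complex_Main
begin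

text \<open>
  An edge is the two-element set of its endpoints, so graphs are undirected, loopless and
  without parallel edges. The value of \<open>weight\<close> outside \<open>edges\<close> is irrelevant.
\<close>

record 'a wgraph =
  verts :: "'a set"
  edges :: "'a set set"
  weight :: "'a set \<Rightarrow> real"

definition is_wgraph :: "'a wgraph \<Rightarrow> bool" where
  "is_wgraph G \<longleftrightarrow>
     finite (verts G) \<and>
     (\<forall>e\<in>edges G. e \<subseteq> verts G \<and> card e = 2) \<and>
     (\<forall>e\<in>edges G. weight G e > 0)"

definition cut_edges :: "'a wgraph \<Rightarrow> 'a set \<Rightarrow> 'a set set" where
  "cut_edges G S = {e \<in> edges G. card (e \<inter> S) = 1}"

definition cut_weight :: "'a wgraph \<Rightarrow> 'a set \<Rightarrow> real" where
  "cut_weight G S = (\<Sum>e\<in>cut_edges G S. weight G e)"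

text \<open>The edges of \<open>H\<close> need not be edges of \<open>G\<close>.\<close>

definition is_cut_sparsifier :: "real \<Rightarrow> 'a wgraph \<Rightarrow> 'a wgraph \<Rightarrow> bool" where
  "is_cut_sparsifier \<epsilon> G H \<longleftrightarrow>
     is_wgraph H \<and> verts H = verts G \<and>
     (\<forall>S. S \<subseteq> verts G \<longrightarrow>
        (1 - \<epsilon>) * cut_weight G S \<le> cut_weight H S \<and>
        cut_weight H S \<le> (1 + \<epsilon>) * cut_weight G S)"

end

theory Submission
  imports Defs "HOL-Analysis.Convex"
begin

text \<open>
  For small \<open>\<epsilon>\<close> take \<open>G\<close> to be a disjoint union of cliques on \<open>m = \<lfloor>1/\<epsilon>\<^sup>2\<rfloor>\<close> vertices; it is enough that \<open>H\<close>
  has \<open>\<Omega>(m\<^sup>2)\<close> edges inside each clique \<open>B\<close>. For disjoint \<open>S, T \<subseteq> B\<close> the weight between \<open>S\<close> and \<open>T\<close> is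
  \<open>(w(S) + w(T) - w(S \<union> T))/2\<close> in terms of cut weights, so in \<open>H\<close> it is \<open>|S||T| + O(\<epsilon>m\<^sup>2)\<close>, that is,
  the matrix of \<open>H\<close> minus the all-ones matrix has discrepancy \<open>O(m\<^sup>3\<^sup>/\<^sup>2)\<close>. If \<open>H\<close> had few edges
  in \<open>B\<close>, half of \<open>B\<close> could be split off so that most rows of this matrix on that half have at most
  \<open>\<gamma>m\<close> nonzero entries of \<open>H\<close>; as these carry total weight about \<open>m/2\<close>, the row has \<open>\<ell>\<^sub>2\<close>-norm
  \<open>\<Omega>(\<surd>(m/\<gamma>))\<close>. By Khintchine's inequality, random signs on the columns followed by optimal signs on
  the rows give discrepancy \<open>\<Omega>(m\<^sup>3\<^sup>/\<^sup>2/\<surd>\<gamma>)\<close>, a contradiction for small \<open>\<gamma>\<close>. For \<open>\<epsilon>\<close> bounded away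
  from \<open>0\<close> it suffices that \<open>H\<close> has no isolated vertices.
\<close>

section \<open>Moments of random signed sums\<close>

lemma sum_Pow_insert:
  fixes f :: "'a set \<Rightarrow> 'b::comm_monoid_add"
  assumes "finite F" "x \<notin> F"
  shows "(\<Sum>S\<in>Pow (insert x F). f S) = (\<Sum>S\<in>Pow F. f S + f (insert x S))"
proof -
  have inj: "inj_on (insert x) (Pow F)"
    using assms(2) by (intro inj_onI) (metis PowD insert_ident subsetD)
  have "(\<Sum>S\<in>Pow (insert x F). f S) = sum f (Pow F) + sum f (insert x ` Pow F)"
    unfolding Pow_insert using assms by (intro sum.union_disjoint) auto
  also have "sum f (insert x ` Pow F) = (\<Sum>S\<in>Pow F. f (insert x S))"
    using inj by (simp add: sum.reindex)
  finally show ?thesis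
    by (simp add: sum.distrib)
qed

text \<open>A Rademacher sum: \<open>S\<close> is the set of coordinates with sign \<open>+\<close>,
  so a sum over \<open>Pow F\<close> is \<open>2 ^ card F\<close> times the expectation over uniform
  signs.\<close>

definition signed_sum :: "('a \<Rightarrow> real) \<Rightarrow> 'a set \<Rightarrow> 'a set \<Rightarrow> real" where
  "signed_sum a F S = (\<Sum>v\<in>F. if v \<in> S then a v else - a v)"

lemma signed_sum_insert:
  assumes "finite F" "x \<notin> F" "S \<subseteq> F"
  shows "signed_sum a (insert x F) S = signed_sum a F S - a x"
    and "signed_sum a (insert x F) (insert x S) = signed_sum a F S + a x"
proof -
  have "x \<notin> S" using assms by auto
  then show "signed_sum a (insert x F) S = signed_sum a F S - a x"
    using assms by (simp add: signed_sum_def)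
  have "(\<Sum>v\<in>F. if v \<in> insert x S then a v else - a v) = signed_sum a F S"
    unfolding signed_sum_def using assms by (intro sum.cong) auto
  then show "signed_sum a (insert x F) (insert x S) = signed_sum a F S + a x"
    using assms by (simp add: signed_sum_def)
qed

text \<open>Orthogonality of the signs: the two choices for a new coordinate cancel the cross
  term.\<close>

lemma sum_signed_sum_power2:
  assumes "finite F"
  shows "(\<Sum>S\<in>Pow F. (signed_sum a F S)\<^sup>2) = 2 ^ card F * (\<Sum>v\<in>F. (a v)\<^sup>2)"
  using assms
proof (induction F rule: finite_induct)
  case empty
  then show ?case by (simp add: signed_sum_def)
next
  case (insert x F)
  have "(\<Sum>S\<in>Pow (insert x F). (signed_sum a (insert x F) S)\<^sup>2)
      = (\<Sum>S\<in>Pow F. (signed_sum a F S - a x)\<^sup>2 + (signed_sum a F S + a x)\<^sup>2)"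
    unfolding sum_Pow_insert[OF insert.hyps(1,2)]
    by (intro sum.cong refl) (simp add: signed_sum_insert insert.hyps)
  also have "\<dots> = (\<Sum>S\<in>Pow F. 2 * (signed_sum a F S)\<^sup>2 + 2 * (a x)\<^sup>2)"
    by (intro sum.cong refl) (simp add: power2_eq_square algebra_simps)
  also have "\<dots> = 2 * (\<Sum>S\<in>Pow F. (signed_sum a F S)\<^sup>2) + 2 ^ card F * (2 * (a x)\<^sup>2)"
    using insert.hyps by (simp add: sum.distrib sum_distrib_left card_Pow)
  finally show ?case
    using insert by (simp add: algebra_simps)
qed

text \<open>Odd powers of \<open>a x\<close> cancel between its two signs, and the mixed even term
  is evaluated by the second moment.\<close>

lemma sum_signed_sum_power4_le:
  assumes "finite F"
  shows "(\<Sum>S\<in>Pow F. (signed_sum a F S) ^ 4) \<le> 3 * 2 ^ card F * (\<Sum>v\<in>F. (a v)\<^sup>2)\<^sup>2"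
  using assms
proof (induction F rule: finite_induct)
  case empty
  then show ?case by (simp add: signed_sum_def)
next
  case (insert x F)
  define s where "s = (\<Sum>v\<in>F. (a v)\<^sup>2)"
  have "(\<Sum>S\<in>Pow (insert x F). (signed_sum a (insert x F) S) ^ 4)
      = (\<Sum>S\<in>Pow F. (signed_sum a F S - a x) ^ 4 + (signed_sum a F S + a x) ^ 4)"
    unfolding sum_Pow_insert[OF insert.hyps(1,2)]
    by (intro sum.cong refl) (simp add: signed_sum_insert insert.hyps)
  also have "\<dots> = (\<Sum>S\<in>Pow F. 2 * (signed_sum a F S) ^ 4
      + 12 * (a x)\<^sup>2 * (signed_sum a F S)\<^sup>2 + 2 * (a x) ^ 4)"
    by (intro sum.cong refl) (simp add: power2_eq_square power4_eq_xxxx algebra_simps)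
  also have "\<dots> = 2 * (\<Sum>S\<in>Pow F. (signed_sum a F S) ^ 4)
      + 12 * (a x)\<^sup>2 * (2 ^ card F * s) + 2 ^ card F * (2 * (a x) ^ 4)"
    using insert.hyps
    by (simp add: sum.distrib sum_distrib_left[symmetric] card_Pow sum_signed_sum_power2 s_def)
  \<comment> \<open>Raising the coefficient of \<open>(a x) ^ 4\<close> from 2 to 6 completes the
    square.\<close>
  also have "\<dots> \<le> 2 * (3 * 2 ^ card F * s\<^sup>2)
      + 12 * (a x)\<^sup>2 * (2 ^ card F * s) + 2 ^ card F * (6 * (a x) ^ 4)"
    using insert.IH by (intro add_mono mult_left_mono) (auto simp: s_def)
  also have "\<dots> = 3 * 2 ^ card (insert x F) * ((a x)\<^sup>2 + s)\<^sup>2"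
    using insert.hyps by (simp add: power2_eq_square power4_eq_xxxx algebra_simps)
  also have "(a x)\<^sup>2 + s = (\<Sum>v\<in>insert x F. (a v)\<^sup>2)"
    using insert.hyps by (simp add: s_def)
  finally show ?case .
qed

text \<open>Scaling by \<open>t = \<bar>x\<bar> / s\<close> reduces this to
  \<open>t - t ^ 3 / 6 \<le> 1\<close>. The coefficient 1/6 is large enough for that, and small
  enough that a fourth moment of at most \<open>3 * s ^ 4\<close> costs only
  \<open>s / 2\<close>.\<close>

lemma abs_ge_power2_power4:
  fixes x s :: real
  assumes "s > 0"
  shows "x\<^sup>2 / s - x ^ 4 / (6 * s ^ 3) \<le> \<bar>x\<bar>"
proof -
  define t where "t = \<bar>x\<bar> / s"
  have t0: "t \<ge> 0" using assms by (simp add: t_def)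
  have "t - t ^ 3 / 6 \<le> 1"
  proof -
    \<comment> \<open>\<open>7/5\<close> approximates \<open>\<surd>2\<close>, the maximum point of \<open>t - t\<^sup>3/6\<close>\<close>
    have "0 \<le> (t - 7/5)\<^sup>2 * (t + 14/5)"
      using t0 by simp
    also have "\<dots> = t ^ 3 - (147/25) * t + 686/125"
      by (simp add: power2_eq_square power3_eq_cube field_simps)
    finally have 1: "t ^ 3 \<ge> (147/25) * t - 686/125" by simp
    \<comment> \<open>The cubic bound gives at most \<open>t / 50 + 343 / 375\<close>, which stays
      below 1 only for moderate \<open>t\<close>; beyond 4 the cubic term alone exceeds
      \<open>t\<close>.\<close>
    show ?thesis
    proof (cases "t \<le> 4")
      case True
      then show ?thesis using 1 by simp
    next
      case False
      then have "t * 16 \<le> t * t\<^sup>2"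
        using power_mono[of 4 t 2] by (intro mult_left_mono) auto
      then show ?thesis using t0 by (simp add: power3_eq_cube power2_eq_square)
    qed
  qed
  then have "t * (t - t ^ 3 / 6) \<le> t * 1"
    using t0 by (rule mult_left_mono)
  then have *: "s * (t * (t - t ^ 3 / 6)) \<le> s * t"
    using assms by simp
  have "\<bar>x\<bar> = s * t" using assms by (simp add: t_def)
  then have "x\<^sup>2 = (s * t)\<^sup>2" "x ^ 4 = (s * t) ^ 4"
    by (metis power2_abs, metis power_even_abs even_numeral)
  then have "x\<^sup>2 / s - x ^ 4 / (6 * s ^ 3) = s * (t * (t - t ^ 3 / 6))"
    using assms by (simp add: power2_eq_square power3_eq_cube power4_eq_xxxx field_simps)
  then show ?thesis using * \<open>\<bar>x\<bar> = s * t\<close> by simp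
qed

text \<open>Khintchine's inequality: the first absolute moment is recovered from the second and the
  fourth.\<close>

lemma khintchine_L1:
  assumes "finite F"
  shows "2 ^ card F * sqrt (\<Sum>v\<in>F. (a v)\<^sup>2) / 2 \<le> (\<Sum>S\<in>Pow F. \<bar>signed_sum a F S\<bar>)"
proof (cases "(\<Sum>v\<in>F. (a v)\<^sup>2) = 0")
  case True
  then show ?thesis by (simp add: sum_nonneg)
next
  case False
  define q where "q = (\<Sum>v\<in>F. (a v)\<^sup>2)"
  define s where "s = sqrt q"
  have "q > 0" using False sum_nonneg[of F "\<lambda>v. (a v)\<^sup>2"] unfolding q_def by simp
  then have s: "s > 0" "s\<^sup>2 = q" by (simp_all add: s_def)
  let ?X = "signed_sum a F"
  \<comment> \<open>On average the second moment contributes \<open>s\<close> and the fourth costs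
    at most \<open>s / 2\<close>.\<close>
  have "2 ^ card F * s / 2 = 2 ^ card F * q / s - 3 * 2 ^ card F * q\<^sup>2 / (6 * s ^ 3)"
    using s(1) by (simp add: s(2)[symmetric] power2_eq_square power3_eq_cube field_simps)
  also have "\<dots> \<le> (\<Sum>S\<in>Pow F. (?X S)\<^sup>2) / s - (\<Sum>S\<in>Pow F. (?X S) ^ 4) / (6 * s ^ 3)"
    using s(1) sum_signed_sum_power4_le[OF assms, of a]
    by (intro diff_mono divide_right_mono) (auto simp: sum_signed_sum_power2[OF assms] q_def)
  also have "\<dots> = (\<Sum>S\<in>Pow F. (?X S)\<^sup>2 / s - (?X S) ^ 4 / (6 * s ^ 3))"
    by (simp add: sum_subtractf sum_divide_distrib)
  also have "\<dots> \<le> (\<Sum>S\<in>Pow F. \<bar>?X S\<bar>)"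
    using s(1) by (intro sum_mono abs_ge_power2_power4)
  finally show ?thesis by (simp add: s_def q_def)
qed

section \<open>Sparse rows and discrepancy of a matrix\<close>

text \<open>Cauchy-Schwarz on the support: a row with few nonzero entries but a large sum is far
  from the all-ones row in Euclidean norm.\<close>

lemma sum_minus_card_support_le:
  fixes w :: "'a \<Rightarrow> real"
  assumes "finite V" and "real (card {v\<in>V. w v \<noteq> 0}) \<le> D"
  shows "(\<Sum>v\<in>V. w v) - D \<le> sqrt D * sqrt (\<Sum>v\<in>V. (w v - 1)\<^sup>2)"
proof -
  let ?N = "{v\<in>V. w v \<noteq> 0}"
  have "(\<Sum>v\<in>V. w v) = (\<Sum>v\<in>?N. w v)"
    using assms(1) by (intro sum.mono_neutral_right) auto
  then have "(\<Sum>v\<in>V. w v) - D \<le> (\<Sum>v\<in>?N. w v - 1)"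
    using assms(2) by (simp add: sum_subtractf)
  also have "\<dots> \<le> sqrt ((\<Sum>v\<in>?N. w v - 1)\<^sup>2)"
    by simp
  also have "\<dots> \<le> sqrt ((\<Sum>v\<in>?N. (w v - 1)\<^sup>2) * card ?N)"
    using sum_squared_le_sum_of_squares[of "\<lambda>v. w v - 1" ?N] by (intro real_sqrt_le_mono)
  also have "\<dots> \<le> sqrt ((\<Sum>v\<in>V. (w v - 1)\<^sup>2) * D)"
    using assms by (intro real_sqrt_le_mono mult_mono sum_mono2) (auto simp: sum_nonneg)
  finally show ?thesis
    by (simp add: real_sqrt_mult mult.commute)
qed

text \<open>Khintchine row by row, then averaging over the column signs: one sign pattern
  \<open>S\<close> serves all rows at once.\<close>

lemma sparse_rows_signing:
  fixes w :: "'a \<Rightarrow> 'b \<Rightarrow> real" and D :: real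
  assumes "finite U" "finite V" and "D > 0"
    and sparse: "\<And>u. u \<in> U \<Longrightarrow> real (card {v\<in>V. w u v \<noteq> 0}) \<le> D"
  obtains S where "S \<subseteq> V"
    "(\<Sum>u\<in>U. \<Sum>v\<in>V. w u v) - card U * D
       \<le> 2 * sqrt D * (\<Sum>u\<in>U. \<bar>signed_sum (\<lambda>v. w u v - 1) V S\<bar>)"
proof -
  define L where "L = (\<Sum>u\<in>U. \<Sum>v\<in>V. w u v) - card U * D"
  define X where "X S = (\<Sum>u\<in>U. \<bar>signed_sum (\<lambda>v. w u v - 1) V S\<bar>)" for S
  have "L = (\<Sum>u\<in>U. (\<Sum>v\<in>V. w u v) - D)"
    by (simp add: L_def sum_subtractf)
  also have "\<dots> \<le> (\<Sum>u\<in>U. sqrt D * sqrt (\<Sum>v\<in>V. (w u v - 1)\<^sup>2))"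
    using assms by (intro sum_mono sum_minus_card_support_le)
  finally have "2 ^ card V * L \<le> 2 ^ card V * (\<Sum>u\<in>U. sqrt D * sqrt (\<Sum>v\<in>V. (w u v - 1)\<^sup>2))"
    by simp
  also have "\<dots> = 2 * sqrt D * (\<Sum>u\<in>U. 2 ^ card V * sqrt (\<Sum>v\<in>V. (w u v - 1)\<^sup>2) / 2)"
    by (simp add: sum_distrib_left mult_ac)
  also have "\<dots> \<le> 2 * sqrt D * (\<Sum>u\<in>U. \<Sum>S\<in>Pow V. \<bar>signed_sum (\<lambda>v. w u v - 1) V S\<bar>)"
    using assms by (intro mult_left_mono sum_mono khintchine_L1) auto
  also have "\<dots> = (\<Sum>S\<in>Pow V. 2 * sqrt D * X S)"
    unfolding X_def by (subst sum.swap) (simp add: sum_distrib_left)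
  finally have avg: "2 ^ card V * L \<le> (\<Sum>S\<in>Pow V. 2 * sqrt D * X S)" .
  have "\<exists>S\<in>Pow V. L \<le> 2 * sqrt D * X S"
  proof (rule ccontr)
    assume "\<not> ?thesis"
    then have "(\<Sum>S\<in>Pow V. 2 * sqrt D * X S) < (\<Sum>S\<in>Pow V. L)"
      using assms by (intro sum_strict_mono) (auto simp: not_le)
    then show False using avg assms(2) by (simp add: card_Pow)
  qed
  then show ?thesis using that unfolding L_def X_def by auto
qed

text \<open>Matching each row sign to its signed sum splits the total into four rectangles,
  \<open>T\<close> or \<open>U - T\<close> times \<open>S\<close> or \<open>V - S\<close>, each
  contributing at most \<delta>.\<close>

lemma sum_abs_signed_sum_le:
  fixes a :: "'a \<Rightarrow> 'b \<Rightarrow> real"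
  assumes "finite U" "finite V" "S \<subseteq> V"
    and disc: "\<And>T S. T \<subseteq> U \<Longrightarrow> S \<subseteq> V \<Longrightarrow> \<bar>\<Sum>u\<in>T. \<Sum>v\<in>S. a u v\<bar> \<le> \<delta>"
  shows "(\<Sum>u\<in>U. \<bar>signed_sum (a u) V S\<bar>) \<le> 4 * \<delta>"
proof -
  have X: "signed_sum (a u) V S = (\<Sum>v\<in>S. a u v) - (\<Sum>v\<in>V - S. a u v)" for u
  proof -
    have "signed_sum (a u) V S = (\<Sum>v\<in>S. if v \<in> S then a u v else - a u v)
        + (\<Sum>v\<in>V - S. if v \<in> S then a u v else - a u v)"
      unfolding signed_sum_def by (subst sum.subset_diff[OF assms(3,2)]) (rule add.commute)
    then show ?thesis by (simp add: sum_negf)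
  qed
  define T where "T = {u\<in>U. signed_sum (a u) V S \<ge> 0}"
  have T: "T \<subseteq> U" by (auto simp: T_def)
  have "(\<Sum>u\<in>U. \<bar>signed_sum (a u) V S\<bar>)
      = (\<Sum>u\<in>T. \<bar>signed_sum (a u) V S\<bar>) + (\<Sum>u\<in>U - T. \<bar>signed_sum (a u) V S\<bar>)"
    by (subst sum.subset_diff[OF T assms(1)]) (rule add.commute)
  also have "\<dots> = (\<Sum>u\<in>T. signed_sum (a u) V S) + (\<Sum>u\<in>U - T. - signed_sum (a u) V S)"
    by (intro arg_cong2[where f = "(+)"] sum.cong) (auto simp: T_def)
  also have "\<dots> = (\<Sum>u\<in>T. \<Sum>v\<in>S. a u v) - (\<Sum>u\<in>T. \<Sum>v\<in>V - S. a u v)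
      - (\<Sum>u\<in>U - T. \<Sum>v\<in>S. a u v) + (\<Sum>u\<in>U - T. \<Sum>v\<in>V - S. a u v)"
    by (simp add: X sum_subtractf sum_negf)
  also have "\<dots> \<le> 4 * \<delta>"
    using disc[OF T assms(3)] disc[OF T Diff_subset[of V S]]
      disc[OF Diff_subset[of U T] assms(3)] disc[OF Diff_subset[of U T] Diff_subset[of V S]] by linarith
  finally show ?thesis .
qed

section \<open>Cut weights and the adjacency matrix\<close>

text \<open>The weighted adjacency matrix. The value 0 off the edges makes its support the edge set,
  whatever \<open>weight\<close> is there.\<close>

definition pair_weight :: "'a wgraph \<Rightarrow> 'a \<Rightarrow> 'a \<Rightarrow> real" where
  "pair_weight G u v = (if {u, v} \<in> edges G then weight G {u, v} else 0)"

lemma finite_edges: "is_wgraph G \<Longrightarrow> finite (edges G)"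
  unfolding is_wgraph_def by (rule finite_subset[of _ "Pow (verts G)"]) auto

lemma cut_weight_nonneg: "is_wgraph G \<Longrightarrow> cut_weight G S \<ge> 0"
  unfolding is_wgraph_def cut_weight_def cut_edges_def by (intro sum_nonneg) force

text \<open>The share of one edge in the cut identity that follows: an edge joining \<open>S\<close>
  to \<open>T\<close> is cut by both sets but not by their union; every other edge cancels.\<close>

lemma card_Int_eq_1_disjoint:
  assumes "card e = 2" "S \<inter> T = {}"
  shows "of_bool (card (e \<inter> S) = 1) + of_bool (card (e \<inter> T) = 1)
       - of_bool (card (e \<inter> (S \<union> T)) = 1)
     = (2 * of_bool (card (e \<inter> S) = 1 \<and> card (e \<inter> T) = 1) :: real)"
proof -
  obtain x y where e: "e = {x, y}" "x \<noteq> y" using assms(1) by (auto simp: card_2_iff)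
  have "{x, y} \<inter> A = (if x \<in> A then {x} else {}) \<union> (if y \<in> A then {y} else {})" for A
    by auto
  then show ?thesis using assms(2) e
    by (cases "x \<in> S"; cases "y \<in> S"; cases "x \<in> T"; cases "y \<in> T") auto
qed

text \<open>A sparsifier controls cuts only; this turns them into sums over rectangles of the
  adjacency matrix.\<close>

lemma cut_weight_disjoint:
  assumes G: "is_wgraph G" and fin: "finite S" "finite T" and disj: "S \<inter> T = {}"
  shows "cut_weight G S + cut_weight G T - cut_weight G (S \<union> T)
       = 2 * (\<Sum>u\<in>S. \<Sum>v\<in>T. pair_weight G u v)"
proof -
  have finE: "finite (edges G)" using G by (rule finite_edges)
  have card2: "card e = 2" if "e \<in> edges G" for e
    using G that by (auto simp: is_wgraph_def)
  have cut: "cut_weight G A = (\<Sum>e\<in>edges G. weight G e * of_bool (card (e \<inter> A) = 1))" for A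
    unfolding cut_weight_def cut_edges_def sum.inter_filter[OF finE] by (intro sum.cong) auto
  define C where "C = {e\<in>edges G. card (e \<inter> S) = 1 \<and> card (e \<inter> T) = 1}"
  define P where "P = {p\<in>S \<times> T. {fst p, snd p} \<in> edges G}"
  have "cut_weight G S + cut_weight G T - cut_weight G (S \<union> T)
      = (\<Sum>e\<in>edges G. weight G e * (of_bool (card (e \<inter> S) = 1) + of_bool (card (e \<inter> T) = 1)
           - of_bool (card (e \<inter> (S \<union> T)) = 1)))"
    unfolding cut by (simp only: sum.distrib sum_subtractf distrib_left right_diff_distrib)
  also have "\<dots> = (\<Sum>e\<in>edges G. weight G e *
      (2 * of_bool (card (e \<inter> S) = 1 \<and> card (e \<inter> T) = 1)))"
    by (intro sum.cong refl arg_cong2[where f = "(*)"] card_Int_eq_1_disjoint card2 disj)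
  also have "\<dots> = 2 * (\<Sum>e\<in>C. weight G e)"
    unfolding C_def sum.inter_filter[OF finE] sum_distrib_left by (intro sum.cong) auto
  \<comment> \<open>As \<open>S\<close> and \<open>T\<close> are disjoint, each edge between them
    comes from exactly one ordered pair.\<close>
  also have "(\<Sum>e\<in>C. weight G e) = (\<Sum>p\<in>P. weight G {fst p, snd p})"
  proof (rule sum.reindex_bij_betw[symmetric], rule bij_betw_imageI)
    show "inj_on (\<lambda>p. {fst p, snd p}) P"
      using disj unfolding P_def inj_on_def by (force simp: doubleton_eq_iff)
    show "(\<lambda>p. {fst p, snd p}) ` P = C"
    proof
      show "(\<lambda>p. {fst p, snd p}) ` P \<subseteq> C"
      proof clarify
        fix u v assume "(u, v) \<in> P"
        then have uv: "u \<in> S" "v \<in> T" "{u, v} \<in> edges G" by (auto simp: P_def)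
        then have "{u, v} \<inter> S = {u}" "{u, v} \<inter> T = {v}" using disj by blast+
        then have "card ({u, v} \<inter> S) = 1" "card ({u, v} \<inter> T) = 1" by simp_all
        then show "{fst (u, v), snd (u, v)} \<in> C" using uv(3) by (simp add: C_def)
      qed
      show "C \<subseteq> (\<lambda>p. {fst p, snd p}) ` P"
      proof
        fix e assume e: "e \<in> C"
        then obtain u v where uv: "e \<inter> S = {u}" "e \<inter> T = {v}"
          by (auto simp: C_def card_1_singleton_iff)
        have "card e = 2" using e card2 by (auto simp: C_def)
        moreover have "u \<noteq> v" using uv disj by auto
        ultimately have "{u, v} = e"
          using uv by (intro card_subset_eq) (auto intro: card_ge_0_finite)
        moreover have "(u, v) \<in> P" using uv e \<open>{u, v} = e\<close> by (auto simp: P_def C_def)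
        ultimately show "e \<in> (\<lambda>p. {fst p, snd p}) ` P" by force
      qed
    qed
  qed
  also have "\<dots> = (\<Sum>(u, v)\<in>S \<times> T. pair_weight G u v)"
    unfolding P_def using fin
    by (subst sum.inter_filter) (auto intro!: sum.cong simp: pair_weight_def)
  finally show ?thesis by (simp add: sum.cartesian_product)
qed

section \<open>Sparsifying an isolated clique\<close>

text \<open>The rectangle sum is half a combination of three cuts, each preserved up to an error
  \<open>\<epsilon> * (card B)\<^sup>2 / 2\<close>; hence the factor 3/4.\<close>

lemma sparsifier_clique_discrepancy:
  assumes G: "is_wgraph G" and H: "is_cut_sparsifier \<epsilon> G H" and "0 < \<epsilon>"
    and B: "B \<subseteq> verts G" "cut_weight G B = 0"
    and clique: "\<And>u v. u \<in> B \<Longrightarrow> v \<in> B \<Longrightarrow> u \<noteq> v \<Longrightarrow> pair_weight G u v = 1"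
    and ST: "S \<subseteq> B" "T \<subseteq> B" "S \<inter> T = {}"
  shows "\<bar>\<Sum>u\<in>S. \<Sum>v\<in>T. pair_weight H u v - 1\<bar> \<le> 3/4 * \<epsilon> * (real (card B))\<^sup>2"
proof -
  define b where "b = real (card B)"
  have finB: "finite B" using G B by (auto simp: is_wgraph_def intro: finite_subset)
  have H': "is_wgraph H"
    and sp: "\<And>A. A \<subseteq> B \<Longrightarrow> \<bar>cut_weight H A - cut_weight G A\<bar> \<le> \<epsilon> * cut_weight G A"
    using H B by (auto simp: is_cut_sparsifier_def abs_le_iff algebra_simps)
  have cross: "(\<Sum>u\<in>A. \<Sum>v\<in>C. pair_weight G u v) = real (card A) * real (card C)"
    if "A \<subseteq> B" "C \<subseteq> B" "A \<inter> C = {}" for A C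
  proof -
    have "(\<Sum>u\<in>A. \<Sum>v\<in>C. pair_weight G u v) = (\<Sum>u\<in>A. \<Sum>v\<in>C. 1)"
      using that by (intro sum.cong refl clique) auto
    then show ?thesis by simp
  qed
  have fin: "finite A" if "A \<subseteq> B" for A using that finB by (rule finite_subset)
  \<comment> \<open>The cut identity is applied to \<open>A\<close> and \<open>B - A\<close>, whose
    union has cut weight 0. Dropping the cut of \<open>B - A\<close> loses a harmless factor
    2.\<close>
  have cutG: "cut_weight G A \<le> b\<^sup>2 / 2" if A: "A \<subseteq> B" for A
  proof -
    define x y where "x = real (card A)" and "y = real (card (B - A))"
    have "b = x + y"
      unfolding b_def x_def y_def using A finB card_mono[OF finB A]
      by (simp add: card_Diff_subset fin of_nat_diff)
    have "cut_weight G A + cut_weight G (B - A) - cut_weight G (A \<union> (B - A)) = 2 * (x * y)"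
      unfolding x_def y_def using A
      by (subst cut_weight_disjoint[OF G]) (auto simp: fin cross)
    moreover have "A \<union> (B - A) = B" using A by auto
    ultimately have "cut_weight G A \<le> 2 * (x * y)"
      using B(2) cut_weight_nonneg[OF G, of "B - A"] by simp
    also have "\<dots> \<le> b\<^sup>2 / 2"
      using zero_le_power2[of "x - y"] unfolding \<open>b = x + y\<close>
      by (simp add: power2_eq_square algebra_simps)
    finally show ?thesis .
  qed
  have diff: "\<bar>cut_weight H A - cut_weight G A\<bar> \<le> \<epsilon> * (b\<^sup>2 / 2)" if "A \<subseteq> B" for A
    using sp[OF that] mult_left_mono[OF cutG[OF that], of \<epsilon>] \<open>0 < \<epsilon>\<close> by linarith
  have "2 * (\<Sum>u\<in>S. \<Sum>v\<in>T. pair_weight H u v - 1)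
      = 2 * (\<Sum>u\<in>S. \<Sum>v\<in>T. pair_weight H u v) - 2 * (\<Sum>u\<in>S. \<Sum>v\<in>T. pair_weight G u v)"
    by (simp add: cross ST sum_subtractf)
  also have "\<dots> = (cut_weight H S - cut_weight G S) + (cut_weight H T - cut_weight G T)
      - (cut_weight H (S \<union> T) - cut_weight G (S \<union> T))"
    using cut_weight_disjoint[OF H' fin fin ST(3)] cut_weight_disjoint[OF G fin fin ST(3)] ST
    by simp
  finally show ?thesis
    using diff[OF ST(1)] diff[OF ST(2)] diff[of "S \<union> T"] ST(1,2)
    unfolding b_def[symmetric] abs_le_iff by (simp add: field_simps)
qed

text \<open>Few edges would leave most rows between two halves of \<open>B\<close>, of size
  \<open>h\<close>, with at most \<open>D\<close> nonzero entries. Some signing then has discrepancy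
  of order \<open>h\<^sup>2 / sqrt D\<close>, while the cuts allow only order
  \<open>\<epsilon> * h\<^sup>2\<close>; the bound \<open>eb\<close> makes
  \<open>\<epsilon> * sqrt D\<close> small.\<close>

lemma sparsifier_clique_edges:
  assumes G: "is_wgraph G" and H: "is_cut_sparsifier \<epsilon> G H" and eps: "0 < \<epsilon>" "\<epsilon> \<le> 1/56"
    and B: "B \<subseteq> verts G" "cut_weight G B = 0"
    and clique: "\<And>u v. u \<in> B \<Longrightarrow> v \<in> B \<Longrightarrow> u \<noteq> v \<Longrightarrow> pair_weight G u v = 1"
    and b2: "2 \<le> card B" and eb: "\<epsilon>\<^sup>2 * card B \<le> 1"
  shows "(real (card B))\<^sup>2 / (9 * 10 ^ 6) \<le> card {e\<in>edges H. e \<subseteq> B}"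
proof (rule ccontr)
  assume few: "\<not> ?thesis"
  define E where "E = {e\<in>edges H. e \<subseteq> B}"
  define k where "k = card B div 2"
  define h where "h = real k"
  define D where "D = 2 * h / 10 ^ 6"
  define \<delta> where "\<delta> = 3/4 * \<epsilon> * (real (card B))\<^sup>2"
  have H': "is_wgraph H" using H by (simp add: is_cut_sparsifier_def)
  have finB: "finite B" using G B by (auto simp: is_wgraph_def intro: finite_subset)
  \<comment> \<open>The factor 3 absorbs the rounding for odd \<open>card B\<close>:
    \<open>2 * k + 1 \<le> 3 * k\<close>.\<close>
  have k: "k \<ge> 1" "2 * k \<le> card B" "card B \<le> 3 * k" using b2 unfolding k_def by linarith+
  then have h: "h \<ge> 1" "2 * h \<le> card B" "card B \<le> 3 * h" unfolding h_def by linarith+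
  have D: "D > 0" using h by (simp add: D_def)
  have bh: "(real (card B))\<^sup>2 \<le> 9 * h\<^sup>2"
    using power_mono[OF h(3), of 2] by (simp add: power_mult_distrib)
  \<comment> \<open>\<open>D\<close> is twice the average row degree that so few edges permit, ready
    for Markov's inequality.\<close>
  have cardE: "card E < D * (h / 2)"
    using few bh unfolding E_def D_def by (simp add: power2_eq_square)
  have \<delta>h: "\<delta> \<le> 27/4 * \<epsilon> * h\<^sup>2"
    using mult_left_mono[OF bh, of "3/4 * \<epsilon>"] eps by (simp add: \<delta>_def)
  obtain V where V: "V \<subseteq> B" "card V = k" "finite V"
    using obtain_subset_with_card_n[of k B] k by auto
  \<comment> \<open>Disjoint row and column sets avoid the diagonal and make distinct nonzero
    entries distinct edges.\<close>
  have "k \<le> card (B - V)" using k V by (simp add: card_Diff_subset)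
  then obtain U\<^sub>0 where U\<^sub>0: "U\<^sub>0 \<subseteq> B - V" "card U\<^sub>0 = k" "finite U\<^sub>0"
    by (rule obtain_subset_with_card_n)
  define d where "d u = card {v\<in>V. pair_weight H u v \<noteq> 0}" for u
  define U where "U = {u\<in>U\<^sub>0. d u \<le> D}"
  have U: "U \<subseteq> U\<^sub>0" "finite U" using U\<^sub>0 by (auto simp: U_def)
  have disc: "\<bar>\<Sum>u\<in>T. \<Sum>v\<in>S. pair_weight H u v - 1\<bar> \<le> \<delta>" if "T \<subseteq> U" "S \<subseteq> V" for S T
    unfolding \<delta>_def using that U U\<^sub>0 V
    by (intro sparsifier_clique_discrepancy[OF G H eps(1) B clique]) auto
  have "(\<Sum>u\<in>U\<^sub>0. d u) = card (SIGMA u:U\<^sub>0. {v\<in>V. pair_weight H u v \<noteq> 0})"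
    using U\<^sub>0 V by (simp add: d_def)
  also have "\<dots> \<le> card E"
  proof (rule card_inj_on_le)
    show "inj_on (\<lambda>(u, v). {u, v}) (SIGMA u:U\<^sub>0. {v\<in>V. pair_weight H u v \<noteq> 0})"
      using U\<^sub>0 unfolding inj_on_def by (force simp: doubleton_eq_iff)
    show "(\<lambda>(u, v). {u, v}) ` (SIGMA u:U\<^sub>0. {v\<in>V. pair_weight H u v \<noteq> 0}) \<subseteq> E"
      using U\<^sub>0 V by (auto simp: E_def pair_weight_def split: if_splits)
    show "finite E" using finite_edges[OF H'] by (simp add: E_def)
  qed
  finally have degs: "(\<Sum>u\<in>U\<^sub>0. d u) \<le> card E" .
  \<comment> \<open>Markov's inequality: fewer than half of the rows have degree above
    \<open>D\<close>.\<close>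
  have "D * card (U\<^sub>0 - U) = (\<Sum>u\<in>U\<^sub>0 - U. D)" by simp
  also have "\<dots> \<le> (\<Sum>u\<in>U\<^sub>0 - U. real (d u))"
    by (intro sum_mono) (auto simp: U_def)
  also have "\<dots> \<le> (\<Sum>u\<in>U\<^sub>0. real (d u))"
    using U\<^sub>0 by (intro sum_mono2) auto
  also have "\<dots> \<le> card E" using degs by (simp flip: of_nat_sum)
  also have "\<dots> < D * (h / 2)" by (rule cardE)
  finally have "card (U\<^sub>0 - U) < h / 2" using D by simp
  moreover have "real (card (U\<^sub>0 - U)) = h - card U"
    using U U\<^sub>0 card_mono[OF U\<^sub>0(3) U(1)] by (simp add: card_Diff_subset h_def of_nat_diff)
  ultimately have cardU: "card U \<ge> h / 2" by simp
  have "real (card {v\<in>V. pair_weight H u v \<noteq> 0}) \<le> D" if "u \<in> U" for u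
    using that by (simp add: U_def d_def)
  then obtain S where S: "S \<subseteq> V" "(\<Sum>u\<in>U. \<Sum>v\<in>V. pair_weight H u v) - card U * D
       \<le> 2 * sqrt D * (\<Sum>u\<in>U. \<bar>signed_sum (\<lambda>v. pair_weight H u v - 1) V S\<bar>)"
    by (rule sparse_rows_signing[OF U(2) V(3) D])
  have "(\<Sum>u\<in>U. \<Sum>v\<in>V. pair_weight H u v) \<ge> card U * h - \<delta>"
    using disc[OF order_refl order_refl] V by (simp add: sum_subtractf h_def abs_le_iff)
  then have "card U * (h - D) - \<delta> \<le> (\<Sum>u\<in>U. \<Sum>v\<in>V. pair_weight H u v) - card U * D"
    by (simp add: algebra_simps)
  also note S(2)
  also have "2 * sqrt D * (\<Sum>u\<in>U. \<bar>signed_sum (\<lambda>v. pair_weight H u v - 1) V S\<bar>)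
      \<le> 2 * sqrt D * (4 * \<delta>)"
    using D by (intro mult_left_mono sum_abs_signed_sum_le U V S disc) auto
  finally have "card U * (h - D) \<le> \<delta> * (1 + 8 * sqrt D)" by (simp add: algebra_simps)
  also have "\<dots> \<le> 27/4 * \<epsilon> * h\<^sup>2 * (1 + 8 * sqrt D)"
    using \<delta>h D by (intro mult_right_mono) auto
  also have "\<dots> = 27/4 * h\<^sup>2 * (\<epsilon> + 8 * (\<epsilon> * sqrt D))" by (simp add: algebra_simps)
  \<comment> \<open>The clique size enters here: \<open>D\<close> is at most
    \<open>card B / 10 ^ 6\<close>.\<close>
  also have "\<epsilon> * sqrt D \<le> 1 / 1000"
  proof -
    have "\<epsilon>\<^sup>2 * D \<le> 1 / 10 ^ 6"
      using mult_left_mono[OF h(2), of "\<epsilon>\<^sup>2"] eb by (simp add: D_def algebra_simps)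
    then have "sqrt (\<epsilon>\<^sup>2 * D) \<le> sqrt ((1 / 1000)\<^sup>2)"
      by (intro real_sqrt_le_mono) (simp add: power2_eq_square)
    then show ?thesis using eps by (simp add: real_sqrt_mult)
  qed
  then have "27/4 * h\<^sup>2 * (\<epsilon> + 8 * (\<epsilon> * sqrt D)) \<le> 27/4 * h\<^sup>2 * (1/56 + 8 * (1 / 1000))"
    using eps by (intro mult_left_mono) auto
  finally have upper: "card U * (h - D) \<le> 27/4 * h\<^sup>2 * (1/56 + 8 * (1 / 1000))" .
  \<comment> \<open>The constants 1/56 and \<open>10 ^ 6\<close> keep the coefficient of
    \<open>h\<^sup>2\<close> in \<open>upper\<close> below 0.175, against 1/4 here.\<close>
  have "h / 2 * (h / 2) \<le> card U * (h - D)"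
    using cardU h(1) by (intro mult_mono) (auto simp: D_def)
  with upper have "h\<^sup>2 \<le> 0" by (simp add: power2_eq_square)
  then show False using h(1) by simp
qed

section \<open>Disjoint unions of cliques\<close>

text \<open>For positive \<open>m\<close>, the cliques are blocks of \<open>m\<close> consecutive
  integers, the last one smaller if \<open>m\<close> does not divide \<open>n\<close>;
  \<open>clusters n n\<close> is the complete graph.\<close>

definition clusters :: "nat \<Rightarrow> nat \<Rightarrow> nat wgraph" where
  "clusters n m = \<lparr>verts = {..<n},
     edges = {e. e \<subseteq> {..<n} \<and> card e = 2 \<and> (\<forall>u\<in>e. \<forall>v\<in>e. u div m = v div m)},
     weight = (\<lambda>_. 1)\<rparr>"

lemma is_wgraph_clusters: "is_wgraph (clusters n m)"
  and verts_clusters: "verts (clusters n m) = {..<n}"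
  by (auto simp: is_wgraph_def clusters_def)

lemma pair_weight_clusters:
  "u < n \<Longrightarrow> v < n \<Longrightarrow> u \<noteq> v \<Longrightarrow> u div m = v div m \<Longrightarrow> pair_weight (clusters n m) u v = 1"
  by (auto simp: pair_weight_def clusters_def)

lemma cut_weight_cluster: "cut_weight (clusters n m) {v. v div m = i} = 0"
proof -
  have "card (e \<inter> {v. v div m = i}) \<noteq> 1" if "e \<in> edges (clusters n m)" for e
  proof -
    have "e \<inter> {v. v div m = i} = e \<or> e \<inter> {v. v div m = i} = {}"
      using that by (auto simp: clusters_def)
    then show ?thesis using that by (auto simp: clusters_def)
  qed
  then show ?thesis by (auto simp: cut_weight_def cut_edges_def intro!: sum.neutral)
qed

lemma div_fibre:
  fixes m i :: nat
  assumes "m > 0"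
  shows "{v. v div m = i} = {i * m..<i * m + m}"
proof (intro set_eqI iffI)
  fix v assume "v \<in> {v. v div m = i}"
  then have "i * m + v mod m = v" using div_mult_mod_eq[of v m] by simp
  moreover have "v mod m < m" using assms by simp
  ultimately show "v \<in> {i * m..<i * m + m}" by simp
next
  fix v assume "v \<in> {i * m..<i * m + m}"
  then have "m * i \<le> v" "v < m * Suc i" by (simp_all add: mult.commute add.commute)
  then show "v \<in> {v. v div m = i}" by (simp add: div_nat_eqI)
qed

text \<open>The clique bound is added up over the \<open>n div m\<close> full blocks.\<close>

lemma clusters_sparsifier_edges:
  assumes H: "is_cut_sparsifier \<epsilon> (clusters n m) H" and eps: "0 < \<epsilon>" "\<epsilon> \<le> 1/56"
    and m: "2 \<le> m" "\<epsilon>\<^sup>2 * m \<le> 1"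
  shows "real (n div m) * ((real m)\<^sup>2 / (9 * 10 ^ 6)) \<le> card (edges H)"
proof -
  define B where "B i = {v. v div m = i}" for i
  define E where "E i = {e\<in>edges H. e \<subseteq> B i}" for i
  have H': "is_wgraph H" using H by (simp add: is_cut_sparsifier_def)
  have finH: "finite (edges H)" by (rule finite_edges[OF H'])
  have B: "B i = {i * m..<i * m + m}" for i using m by (simp add: B_def div_fibre)
  have Bn: "B i \<subseteq> {..<n}" if "i < n div m" for i
  proof -
    have "Suc i * m \<le> n div m * m" using that by (intro mult_right_mono) auto
    also have "\<dots> \<le> n" by simp
    finally show ?thesis by (auto simp: B)
  qed
  have "(real m)\<^sup>2 / (9 * 10 ^ 6) \<le> card (E i)" if i: "i < n div m" for i
  proof -
    have "(real (card (B i)))\<^sup>2 / (9 * 10 ^ 6) \<le> card {e\<in>edges H. e \<subseteq> B i}"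
    proof (rule sparsifier_clique_edges[OF is_wgraph_clusters H eps])
      show "B i \<subseteq> verts (clusters n m)" using Bn[OF i] by (simp add: verts_clusters)
      show "cut_weight (clusters n m) (B i) = 0" by (simp add: B_def cut_weight_cluster)
      show "pair_weight (clusters n m) u v = 1" if "u \<in> B i" "v \<in> B i" "u \<noteq> v" for u v
        using that Bn[OF i] by (intro pair_weight_clusters) (auto simp: B_def)
    qed (use m in \<open>auto simp: B\<close>)
    then show ?thesis by (simp add: E_def B)
  qed
  then have "(\<Sum>i<n div m. (real m)\<^sup>2 / (9 * 10 ^ 6)) \<le> (\<Sum>i<n div m. real (card (E i)))"
    by (intro sum_mono) auto
  also have "\<dots> = card (\<Union>i<n div m. E i)"
  proof -
    \<comment> \<open>Only the empty set lies in two blocks, and it is not an edge.\<close>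
    have "E i \<inter> E j = {}" if "i \<noteq> j" for i j
    proof -
      have "e = {}" if "e \<in> E i \<inter> E j" for e
        using that \<open>i \<noteq> j\<close> by (auto simp: E_def B_def)
      moreover have "{} \<notin> edges H" using H' by (auto simp: is_wgraph_def)
      ultimately show ?thesis by (auto simp: E_def)
    qed
    then show ?thesis
      using finH by (subst card_UN_disjoint) (auto simp: E_def)
  qed
  also have "\<dots> \<le> card (edges H)"
    using finH by (intro of_nat_mono card_mono) (auto simp: E_def)
  finally show ?thesis by simp
qed

section \<open>The complete graph, for \<epsilon> bounded away from 0\<close>

text \<open>Each singleton has a positive cut in the complete graph, hence also in \<open>H\<close>;
  so the edges of \<open>H\<close>, two vertices each, cover everything.\<close>

lemma complete_sparsifier_edges:
  assumes H: "is_cut_sparsifier \<epsilon> (clusters n n) H" and "\<epsilon> < 1" "2 \<le> n"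
  shows "real n \<le> 2 * real (card (edges H))"
proof -
  let ?G = "clusters n n"
  have H': "is_wgraph H" using H by (simp add: is_cut_sparsifier_def)
  have "{..<n} \<subseteq> \<Union>(edges H)"
  proof
    fix v assume v: "v \<in> {..<n}"
    define u :: nat where "u = (if v = 0 then 1 else 0)"
    have u: "u < n" "u \<noteq> v" using \<open>2 \<le> n\<close> by (auto simp: u_def)
    have "{u, v} \<in> cut_edges ?G {v}"
      using u v by (auto simp: cut_edges_def clusters_def)
    moreover have "finite (cut_edges ?G {v})"
      using finite_edges[OF is_wgraph_clusters] by (simp add: cut_edges_def)
    ultimately have "0 < cut_weight ?G {v}"
      unfolding cut_weight_def by (intro sum_pos2) (auto simp: clusters_def)
    then have "0 < (1 - \<epsilon>) * cut_weight ?G {v}" using \<open>\<epsilon> < 1\<close> by simp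
    also have "\<dots> \<le> cut_weight H {v}"
      using H v by (auto simp: is_cut_sparsifier_def verts_clusters)
    finally have "cut_edges H {v} \<noteq> {}" by (auto simp: cut_weight_def)
    then show "v \<in> \<Union>(edges H)" by (auto simp: cut_edges_def card_1_singleton_iff)
  qed
  moreover have "finite (\<Union>(edges H))"
    using finite_edges[OF H'] H' by (auto simp: is_wgraph_def intro: finite_subset)
  ultimately have "n \<le> card (\<Union>(edges H))"
    using card_mono[of "\<Union>(edges H)" "{..<n}"] by simp
  also have "\<dots> \<le> (\<Sum>e\<in>edges H. card e)" by (rule card_Union_le_sum_card)
  also have "\<dots> = (\<Sum>e\<in>edges H. 2)" using H' by (intro sum.cong) (auto simp: is_wgraph_def)
  finally show ?thesis by simp
qed

section \<open>Choice of the clique size\<close>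

theorem theorem3p2:
  "\<exists>c::real. c > 0 \<and>
     (\<forall>(n::nat) (\<epsilon>::real). n \<ge> 1 \<longrightarrow> 1 / sqrt (real n) < \<epsilon> \<longrightarrow> \<epsilon> < 1 \<longrightarrow>
        (\<exists>G :: nat wgraph. is_wgraph G \<and> card (verts G) = n \<and>
           (\<forall>H :: nat wgraph. is_cut_sparsifier \<epsilon> G H \<longrightarrow>
              c * real n / \<epsilon>\<^sup>2 \<le> real (card (edges H)))))"
proof (rule exI[of _ "1 / (36 * 10 ^ 6)"], intro conjI allI impI)
  show "(0::real) < 1 / (36 * 10 ^ 6)" by simp
next
  fix n :: nat and \<epsilon> :: real
  assume n: "n \<ge> 1" and lo: "1 / sqrt (real n) < \<epsilon>" and hi: "\<epsilon> < 1"
  have pos: "\<epsilon> > 0" using lo n by (smt (verit) divide_nonneg_nonneg real_sqrt_ge_zero of_nat_0_le_iff)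
  \<comment> \<open>The lower bound on \<epsilon> ensures that a clique of size about
    \<open>1 / \<epsilon>\<^sup>2\<close> fits into \<open>n\<close> vertices.\<close>
  have "1 / n = (1 / sqrt n)\<^sup>2" by (simp add: power_divide)
  also have "\<dots> < \<epsilon>\<^sup>2" using lo n by (intro power_strict_mono) auto
  finally have n_eps: "1 / \<epsilon>\<^sup>2 < n" using pos n by (simp add: field_simps)
  show "\<exists>G :: nat wgraph. is_wgraph G \<and> card (verts G) = n \<and>
     (\<forall>H. is_cut_sparsifier \<epsilon> G H \<longrightarrow>
        1 / (36 * 10 ^ 6) * real n / \<epsilon>\<^sup>2 \<le> real (card (edges H)))"
  proof (cases "\<epsilon> \<le> 1 / 56")
    case True
    define m where "m = nat \<lfloor>1 / \<epsilon>\<^sup>2\<rfloor>"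
    have m: "m \<le> 1 / \<epsilon>\<^sup>2" "1 / \<epsilon>\<^sup>2 < m + 1"
      unfolding m_def using pos by (simp_all add: of_nat_floor) linarith
    have "56\<^sup>2 \<le> (1 / \<epsilon>)\<^sup>2" using True pos by (intro power_mono) (auto simp: field_simps)
    then have m2: "2 \<le> m" "1 / \<epsilon>\<^sup>2 \<le> 2 * m" using m by (auto simp: power_divide)
    have mn: "m \<le> n" using m n_eps by linarith
    have half: "n \<le> 2 * ((n div m) * m)"
    proof -
      have "n div m \<ge> 1" using mn m2 by (simp add: div_greater_zero_iff Suc_le_eq)
      then have "m \<le> (n div m) * m" by simp
      moreover have "n mod m < m" using m2 by simp
      ultimately show ?thesis using div_mult_mod_eq[of n m] by linarith
    qed
    have "1 / (36 * 10 ^ 6) * real n / \<epsilon>\<^sup>2 \<le> real (card (edges H))"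
      if "is_cut_sparsifier \<epsilon> (clusters n m) H" for H
    proof -
      \<comment> \<open>Discarding the partial block and rounding
        \<open>1 / \<epsilon>\<^sup>2\<close> down each cost a factor 2, whence 36 = 2 * 2 *
        9.\<close>
      have "real n * (1 / \<epsilon>\<^sup>2) \<le> real (2 * ((n div m) * m)) * (2 * real m)"
        using half m2 by (intro mult_mono of_nat_mono) auto
      then have "1 / (36 * 10 ^ 6) * real n / \<epsilon>\<^sup>2 \<le> real (n div m) * ((real m)\<^sup>2 / (9 * 10 ^ 6))"
        by (simp add: power2_eq_square)
      also have "\<dots> \<le> card (edges H)"
        using m pos by (intro clusters_sparsifier_edges[OF that pos True m2(1)]) (simp add: field_simps)
      finally show ?thesis .
    qed
    then show ?thesis
      by (intro exI[of _ "clusters n m"]) (simp add: is_wgraph_clusters verts_clusters)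
  next
    case False
    have "n \<noteq> 1" using lo hi by auto
    then have "2 \<le> n" using n by simp
    \<comment> \<open>Now \<open>n / \<epsilon>\<^sup>2\<close> is at most
      \<open>56\<^sup>2 * n\<close>, so the linear bound \<open>n / 2\<close> suffices.\<close>
    have "(1 / 56)\<^sup>2 \<le> \<epsilon>\<^sup>2" using False by (intro power_mono) auto
    then have "1 / \<epsilon>\<^sup>2 \<le> 56\<^sup>2" using pos by (simp add: field_simps)
    then have "real n * (1 / \<epsilon>\<^sup>2) \<le> real n * 56\<^sup>2" by (intro mult_left_mono) auto
    then have "1 / (36 * 10 ^ 6) * real n / \<epsilon>\<^sup>2 \<le> real n / 2" by simp
    then have "1 / (36 * 10 ^ 6) * real n / \<epsilon>\<^sup>2 \<le> card (edges H)"
      if "is_cut_sparsifier \<epsilon> (clusters n n) H" for H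
      using complete_sparsifier_edges[OF that hi \<open>2 \<le> n\<close>] by linarith
    then show ?thesis
      by (intro exI[of _ "clusters n n"]) (simp add: is_wgraph_clusters verts_clusters)
  qed
qed

end
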